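(* Let $d\ge2$. The set $\{C\in\mathcal{C}_{ar}^d:\mathrm{supp}(\mu_C)=\mathbb{I}^d\}$ is co-meager in $(\mathcal{C}_{ar}^d,d_\infty)$.
   Context: Notation: $\mathbb{I}=[0,1]$; $\inf\emptyset=\infty$. $\mu_C$ is the probability measure on $\mathbb{I}^d$ with distribution function $C$. The support of a finite Borel measure is the complement of the union of all open sets of measure $0$. The uniform metric is $d_\infty(A,B)=\sup_{\mathbf{x}\in\mathbb{I}^d}|A(\mathbf{x})-B(\mathbf{x})|$. A subset of a topological space is meager if it can be covered by countably many nowhere dense sets, and co-meager if its complement is meager. A generator is a continuous non-increasing $\psi:[0,\infty)\to\mathbb{I}$ with $\psi(0)=1$, $\psi(\infty):=\lim_{z\to\infty}\psi(z)=0$, strictly decreasing on $[0,\inf\{x:\psi(x)=0\})$; its pseudo-inverse is $\varphi(y)=\inf\{z\in[0,\infty]:\psi(z)=y\}$, $y\in\mathbb{I}$. $\mathcal{C}_{ar}^d$ is the set of $d$-dimensional Archimedean copulas, i.e. copulas of the form $C(\mathbf{x})=\psi(\sum_{i=1}^d\varphi(x_i))$ (this function is a copula iff $\psi$ is $d$-monotone, i.e., with $\psi$ continuous on $[0,\infty)$, on $(0,\infty)$ $\psi$ is differentiable up to order $d-2$, $(-1)^k\psi^{(k)}\ge0$ for $k\le d-2$, and $(-1)^{d-2}\psi^{(d-2)}$ is non-increasing and convex). *)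

theory Defs
  imports "HOL-Probability.Probability"
begin

section \<open>Copulas and their measures\<close>

text \<open>
  The cube \<open>\<I>\<^sup>d\<close> is \<^term>\<open>{0..1} :: (real ^ 'n) set\<close>, with \<open>d = CARD('n)\<close>; the order on
  \<^typ>\<open>real ^ 'n\<close> is componentwise. A probability measure on the cube is represented by a Borel
  probability measure on \<^typ>\<open>real ^ 'n\<close> giving mass 1 to the cube. Functions on the cube are
  extensional, so that two of them are equal iff they agree on the cube.
\<close>

definition cube_measure_with_df :: "((real ^ 'n) \<Rightarrow> real) \<Rightarrow> (real ^ 'n) measure \<Rightarrow> bool" where
  "cube_measure_with_df C M \<longleftrightarrow>
     prob_space M \<and> sets M = sets borel \<and> measure M {0..1} = 1 \<and>
     (\<forall>x\<in>{0..1}. measure M {..x} = C x)"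

text \<open>A copula is the distribution function of a probability measure on the cube whose
  one-dimensional margins are uniform on \<open>[0,1]\<close>.\<close>

definition copulas :: "((real ^ 'n) \<Rightarrow> real) set" where
  "copulas = {C \<in> extensional {0..1}. \<exists>M. cube_measure_with_df C M \<and>
                (\<forall>i. distr M borel (\<lambda>x. x $ i) = uniform_measure lborel {0..1})}"

definition copula_measure :: "((real ^ 'n) \<Rightarrow> real) \<Rightarrow> (real ^ 'n) measure" where
  "copula_measure C = (THE M. cube_measure_with_df C M)"

definition measure_support :: "'a::topological_space measure \<Rightarrow> 'a set" where
  "measure_support M = - \<Union>{U. open U \<and> emeasure M U = 0}"

lemma emeasure_atMost_cube_measure:
  fixes C :: "(real ^ 'n) \<Rightarrow> real"
  assumes "cube_measure_with_df C M"
  shows "emeasure M {..x} = (if 0 \<le> x then ennreal (C (inf x 1)) else 0)"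
proof -
  interpret prob_space M using assms by (simp add: cube_measure_with_df_def)
  have sets [measurable_cong]: "sets M = sets borel"
    and cube: "measure M {0..1} = 1" and df: "\<And>x. x \<in> {0..1} \<Longrightarrow> measure M {..x} = C x"
    using assms by (auto simp: cube_measure_with_df_def)
  have AE: "AE y in M. y \<in> {0..1}"
    by (rule AE_prob_1) (rule cube)
  show ?thesis
  proof (cases "0 \<le> x")
    case True
    have "emeasure M {..x} = emeasure M {..inf x 1}"
      by (rule emeasure_eq_AE) (use AE in \<open>auto simp: sets\<close>)
    moreover have "inf x 1 \<in> {0..1}"
      using True by (auto simp: less_eq_vec_def inf_vec_def)
    ultimately show ?thesis
      using True df by (simp add: emeasure_eq_measure)
  next
    case False
    have "emeasure M {..x} = emeasure M {}"
      by (rule emeasure_eq_AE) (use AE False in \<open>auto simp: sets\<close>)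
    then show ?thesis
      using False by simp
  qed
qed

lemma cube_measure_with_df_unique:
  fixes C :: "(real ^ 'n) \<Rightarrow> real"
  assumes M: "cube_measure_with_df C M" and N: "cube_measure_with_df C N"
  shows "M = N"
proof (rule measure_eqI_generator_eq[where \<Omega> = UNIV and E = "range (\<lambda>a::real ^ 'n. {..a})"
      and A = "\<lambda>k. {.. (\<chi> i. real k)}"])
  show "Int_stable (range (\<lambda>a::real ^ 'n. {..a}))"
  proof (rule Int_stableI)
    fix A B :: "(real ^ 'n) set"
    assume "A \<in> range atMost" "B \<in> range atMost"
    then obtain a b where "A = {..a}" "B = {..b}" by auto
    then have "A \<inter> B = {..inf a b}" by auto
    then show "A \<inter> B \<in> range atMost" by blast
  qed
  have b: "sets (borel :: (real ^ 'n) measure) = sigma_sets UNIV (range (\<lambda>a. {..a}))"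
    by (subst borel_eq_atMost) simp
  show "sets M = sigma_sets UNIV (range (\<lambda>a. {..a}))" "sets N = sigma_sets UNIV (range (\<lambda>a. {..a}))"
    using M N b by (auto simp: cube_measure_with_df_def)
  show "emeasure M X = emeasure N X" if "X \<in> range (\<lambda>a. {..a})" for X
    using that emeasure_atMost_cube_measure[OF M] emeasure_atMost_cube_measure[OF N] by auto
  show "(\<Union>k. {.. (\<chi> i. real k) :: real ^ 'n}) = UNIV"
  proof (intro equalityI subsetI UNIV_I)
    fix x :: "real ^ 'n"
    obtain k where "norm x \<le> real k" using real_arch_simple by blast
    then have "x \<le> (\<chi> i. real k)"
      unfolding less_eq_vec_def
      by (metis abs_le_D1 component_le_norm_cart order_trans vec_lambda_beta)
    then show "x \<in> (\<Union>k. {.. (\<chi> i. real k)})" by auto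
  qed
  show "emeasure M {.. (\<chi> i. real k)} \<noteq> \<infinity>" for k
    using M by (simp add: cube_measure_with_df_def prob_space.emeasure_le_1 
        prob_space.finite_measure finite_measure.emeasure_finite)
qed auto

lemma cube_measure_with_df_copula_measure:
  assumes "C \<in> copulas"
  shows "cube_measure_with_df C (copula_measure C)"
proof -
  obtain M where "cube_measure_with_df C M" using assms by (auto simp: copulas_def)
  then show ?thesis
    unfolding copula_measure_def by (rule theI) (metis cube_measure_with_df_unique \<open>cube_measure_with_df C M\<close>)
qed


section \<open>Archimedean copulas\<close>

text \<open>Only the values of \<open>\<psi>\<close> on \<open>[0,\<infinity>)\<close> matter. \<open>Inf {} = \<infinity>\<close> holds in \<^typ>\<open>ennreal\<close>.\<close>

definition archimedean_generator :: "(real \<Rightarrow> real) \<Rightarrow> bool" where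
  "archimedean_generator \<psi> \<longleftrightarrow>
     \<psi> ` {0..} \<subseteq> {0..1} \<and> continuous_on {0..} \<psi> \<and> antimono_on {0..} \<psi> \<and>
     \<psi> 0 = 1 \<and> (\<psi> \<longlongrightarrow> 0) at_top \<and>
     strict_antimono_on {z. 0 \<le> z \<and> ennreal z < Inf (ennreal ` {x. 0 \<le> x \<and> \<psi> x = 0})} \<psi>"

text \<open>The extension of a generator to \<open>[0,\<infinity>]\<close> by \<open>\<psi>(\<infinity>) = lim \<psi>(z)\<close>, which is 0.\<close>

definition generator_ext :: "(real \<Rightarrow> real) \<Rightarrow> ennreal \<Rightarrow> real" where
  "generator_ext \<psi> z = (if z = \<infinity> then Lim at_top \<psi> else \<psi> (enn2real z))"

definition pseudo_inverse :: "(real \<Rightarrow> real) \<Rightarrow> real \<Rightarrow> ennreal" where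
  "pseudo_inverse \<psi> y = Inf {z. generator_ext \<psi> z = y}"

definition archimedean_copulas :: "((real ^ 'n) \<Rightarrow> real) set" where
  "archimedean_copulas = {C \<in> copulas. \<exists>\<psi>. archimedean_generator \<psi> \<and>
     (\<forall>x\<in>{0..1}. C x = generator_ext \<psi> (\<Sum>i\<in>UNIV. pseudo_inverse \<psi> (x $ i)))}"


section \<open>The uniform metric\<close>

text \<open>\<^const>\<open>funspace\<close> is the library's supremum metric on bounded extensional functions.\<close>

definition archimedean_metric :: "((real ^ 'n) \<Rightarrow> real) metric" where
  "archimedean_metric = submetric (funspace {0..1} euclidean_metric) archimedean_copulas"

lemma copulas_subset_funspace: "copulas \<subseteq> mspace (funspace {0..1} euclidean_metric)"
proof
  fix C :: "(real ^ 'n) \<Rightarrow> real"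
  assume C: "C \<in> copulas"
  then obtain M where M: "cube_measure_with_df C M" by (auto simp: copulas_def)
  then have "C x = measure M {..x}" "prob_space M" if "x \<in> {0..1}" for x
    using that by (auto simp: cube_measure_with_df_def)
  then have "C ` {0..1} \<subseteq> {0..1}"
    by (auto simp: prob_space.prob_le_1)
  then have "bounded (C ` {0..1})"
    using bounded_subset bounded_closed_interval by metis
  with C show "C \<in> mspace (funspace {0..1} euclidean_metric)"
    by (auto simp: copulas_def Met_TC.fspace_def)
qed

lemma mspace_archimedean_metric [simp]: "mspace archimedean_metric = archimedean_copulas"
  using copulas_subset_funspace
  unfolding archimedean_metric_def mspace_submetric archimedean_copulas_def by blast

lemma mdist_archimedean_metric:
  assumes "A \<in> archimedean_copulas" "B \<in> archimedean_copulas"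
  shows "mdist archimedean_metric A B = (SUP x\<in>{0..1}. \<bar>A x - B x\<bar>)"
proof -
  have "A \<in> Met_TC.fspace {0..1}" "B \<in> Met_TC.fspace {0..1}"
    using assms copulas_subset_funspace by (auto simp: archimedean_copulas_def)
  then show ?thesis
    by (simp add: archimedean_metric_def Met_TC.fdist_def dist_real_def less_eq_vec_def)
qed


section \<open>Baire category\<close>

definition nowhere_dense_in :: "'a topology \<Rightarrow> 'a set \<Rightarrow> bool" where
  "nowhere_dense_in X S \<longleftrightarrow> S \<subseteq> topspace X \<and> X interior_of (X closure_of S) = {}"

definition meager_in :: "'a topology \<Rightarrow> 'a set \<Rightarrow> bool" where
  "meager_in X S \<longleftrightarrow>
     S \<subseteq> topspace X \<and> (\<exists>\<F>. countable \<F> \<and> (\<forall>N\<in>\<F>. nowhere_dense_in X N) \<and> S \<subseteq> \<Union>\<F>)"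

definition comeager_in :: "'a topology \<Rightarrow> 'a set \<Rightarrow> bool" where
  "comeager_in X S \<longleftrightarrow> S \<subseteq> topspace X \<and> meager_in X (topspace X - S)"

end

theory Submission
  imports Defs
begin

text \<open>Let \<open>U\<close> range over a countable basis of \<open>\<real>\<^sup>d\<close>, restricted to the sets that meet the cube. A
  copula without full support gives mass 0 to one of these \<open>U\<close>, so it suffices that the Archimedean
  copulas with \<open>\<mu>\<^sub>C(U) = 0\<close> form a nowhere dense set. The mass of a half-open box is continuous
  in \<open>C\<close>, so one only has to approximate \<open>C\<close> by Archimedean copulas that charge a given box. If
  \<open>\<psi>\<close> generates \<open>C\<close>, then \<open>\<Psi>(z) = (1 - p) \<psi>(z) + p e\<^sup>-\<^sup>z\<close> generates one: its measure is a mixture of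
  monotone coordinatewise images of \<open>\<mu>\<^sub>C\<close> and of the uniform measure on the cube, so no
  characterization of generators by \<open>d\<close>-monotonicity is needed. If \<open>x\<^sub>i = \<Psi>(z\<^sub>i)\<close>, then the new
  copula has the value \<open>\<Psi>(z\<^sub>1 + \<dots> + z\<^sub>d)\<close> at \<open>x\<close>, which differs by at most \<open>p\<close> from
  \<open>\<psi>(z\<^sub>1 + \<dots> + z\<^sub>d) = C(\<psi>(z\<^sub>1), \<dots>, \<psi>(z\<^sub>d))\<close>; as \<open>C\<close> is 1-Lipschitz in each coordinate and
  \<open>|\<psi>(z\<^sub>i) - x\<^sub>i| \<le> p\<close>, the two copulas are at distance at most \<open>(d + 1) p\<close>.\<close>

section \<open>Generators and their inverses\<close>

lemma generator_bounds:
  assumes "archimedean_generator \<psi>" "0 \<le> z"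
  shows "0 \<le> \<psi> z" "\<psi> z \<le> 1"
  using assms by (auto simp: archimedean_generator_def)

lemma generator_antimono:
  assumes "archimedean_generator \<psi>" "0 \<le> z" "z \<le> z'"
  shows "\<psi> z' \<le> \<psi> z"
  using assms by (auto simp: archimedean_generator_def monotone_on_def)

lemma generator_strict:
  assumes g: "archimedean_generator \<psi>" and z: "0 \<le> z" "z < z'" and pos: "0 < \<psi> z"
  shows "\<psi> z' < \<psi> z"
proof (rule ccontr)
  assume neg: "\<not> \<psi> z' < \<psi> z"
  with pos have pos': "0 < \<psi> z'" by simp
  \<comment> \<open>The zeros of \<open>\<psi>\<close> are only seen to lie at or beyond
    \<open>z'\<close>. The midpoint is strictly below their infimum, so strictness applies to
    \<open>z\<close> and the midpoint; antitonicity covers the rest up to \<open>z'\<close>.\<close>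
  let ?m = "(z + z') / 2"
  have "z' \<le> x" if "0 \<le> x" "\<psi> x = 0" for x
    using generator_antimono[OF g that(1), of z'] that pos' by force
  then have "ennreal z' \<le> Inf (ennreal ` {x. 0 \<le> x \<and> \<psi> x = 0})"
    by (auto intro!: Inf_greatest ennreal_leI)
  moreover have "ennreal ?m < ennreal z'" "ennreal z < ennreal z'"
    using z by (auto simp: ennreal_less_iff)
  moreover have "strict_antimono_on {z. 0 \<le> z \<and> ennreal z < Inf (ennreal ` {x. 0 \<le> x \<and> \<psi> x = 0})} \<psi>"
    using g by (simp add: archimedean_generator_def)
  ultimately have "\<psi> ?m < \<psi> z"
    using z by (auto elim!: monotone_onD)
  moreover have "\<psi> z' \<le> \<psi> ?m"
    using generator_antimono[OF g] z by auto
  ultimately show False using neg by simp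
qed

text \<open>If \<open>s < t\<close>, positivity at \<open>s\<close> gives a strict drop. Beyond a
  zero a generator is flat and its values no longer order the arguments.\<close>

lemma generator_le_iff:
  assumes g: "archimedean_generator \<psi>" and "0 \<le> s" "0 \<le> t" "0 < \<psi> s"
  shows "\<psi> s \<le> \<psi> t \<longleftrightarrow> t \<le> s"
  using assms generator_antimono[OF g, of t s] generator_strict[OF g, of s t] by force

lemma generator_surj:
  assumes g: "archimedean_generator \<psi>" and y: "0 < y" "y \<le> 1"
  obtains z where "0 \<le> z" "\<psi> z = y"
proof -
  have "(\<psi> \<longlongrightarrow> 0) at_top" and cont: "continuous_on {0..} \<psi>" and 0: "\<psi> 0 = 1"
    using g by (auto simp: archimedean_generator_def)
  then have "eventually (\<lambda>z. \<psi> z < y \<and> z \<ge> 0) at_top"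
    using y by (intro eventually_conj order_tendstoD(2) eventually_ge_at_top)
  then obtain b where "\<psi> b < y" "0 \<le> b"
    using eventually_happens'[OF trivial_limit_at_top_linorder] by blast
  have "continuous_on {0..b} \<psi>"
    by (rule continuous_on_subset[OF cont]) simp
  then obtain z where "0 \<le> z" "\<psi> z = y"
    using IVT2'[of \<psi> b y 0] y 0 \<open>\<psi> b < y\<close> \<open>0 \<le> b\<close> by auto
  then show thesis by (rule that)
qed

lemma generator_ext_infinity:
  assumes "archimedean_generator \<psi>"
  shows "generator_ext \<psi> \<infinity> = 0"
  using assms tendsto_Lim[of at_top \<psi> 0] by (simp add: generator_ext_def archimedean_generator_def)

lemma generator_ext_ennreal [simp]:
  "0 \<le> z \<Longrightarrow> generator_ext \<psi> (ennreal z) = \<psi> z"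
  by (simp add: generator_ext_def)

text \<open>At a positive level the infimum runs over a singleton: strictness excludes other finite
  arguments, and the value 0 at infinity excludes infinity.\<close>

lemma pseudo_inverse_generator:
  assumes g: "archimedean_generator \<psi>" and z: "0 \<le> z" "0 < \<psi> z"
  shows "pseudo_inverse \<psi> (\<psi> z) = ennreal z"
proof -
  have "w = ennreal z" if w: "generator_ext \<psi> w = \<psi> z" for w
  proof (cases w)
    case (real t)
    then have "\<psi> t = \<psi> z" using w by simp
    then show ?thesis
      using generator_le_iff[OF g, of t z] generator_le_iff[OF g, of z t] z real by force
  next
    case top
    then show ?thesis using w generator_ext_infinity[OF g] z by simp
  qed
  then have "{w. generator_ext \<psi> w = \<psi> z} = {ennreal z}"
    using z by auto
  then show ?thesis by (simp add: pseudo_inverse_def)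
qed

text \<open>Needed when the sum of pseudo-inverses reaches or passes the first zero of
  \<open>\<psi>\<close>, be it finite or infinite.\<close>

lemma generator_ext_eq_0:
  assumes g: "archimedean_generator \<psi>" and w: "pseudo_inverse \<psi> 0 \<le> w"
  shows "generator_ext \<psi> w = 0"
proof (cases w)
  case (real t)
  have "\<psi> t = 0"
  proof (rule ccontr)
    assume "\<psi> t \<noteq> 0"
    then have pos: "0 < \<psi> t" using generator_bounds[OF g] real by force
    \<comment> \<open>Half the value is attained at a point \<open>t'\<close> strictly beyond
      \<open>t\<close> but not beyond any zero, so the infimum of the zeros would exceed
      \<open>t\<close>.\<close>
    have "0 < \<psi> t / 2" "\<psi> t / 2 \<le> 1" using pos generator_bounds[OF g, of t] real by auto
    then obtain t' where t': "0 \<le> t'" "\<psi> t' = \<psi> t / 2" by (rule generator_surj[OF g])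
    have "t < t'"
    proof (rule ccontr)
      assume "\<not> t < t'"
      then have "\<psi> t \<le> \<psi> t'" using t' by (intro generator_antimono[OF g]) auto
      then show False using pos t' by simp
    qed
    have "ennreal t' \<le> v" if "generator_ext \<psi> v = 0" for v
    proof (cases v)
      case v: (real s)
      then have "\<psi> s = 0" using that by simp
      then have "t' \<le> s" using generator_antimono[OF g, of s t'] v t' pos by linarith
      then show ?thesis using v by (simp add: ennreal_leI)
    qed simp
    then have "ennreal t' \<le> pseudo_inverse \<psi> 0"
      unfolding pseudo_inverse_def by (intro Inf_greatest) simp
    also have "\<dots> \<le> ennreal t" using w real by simp
    finally show False using \<open>t < t'\<close> real t' by (simp add: ennreal_le_iff2)
  qed
  then show ?thesis using real by simp
next
  case top
  then show ?thesis using generator_ext_infinity[OF g] by simp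
qed

text \<open>Real-valued inverse for levels in \<open>(0, 1]\<close>, where the pseudo-inverse is
  finite. At level 0 it can be infinite, and \<open>enn2real\<close> then returns the default
  0.\<close>

definition generator_inv :: "(real \<Rightarrow> real) \<Rightarrow> real \<Rightarrow> real" where
  "generator_inv \<psi> y = enn2real (pseudo_inverse \<psi> y)"

lemma generator_inv_nonneg [simp]: "0 \<le> generator_inv \<psi> y"
  by (simp add: generator_inv_def)

lemma generator_inv:
  assumes g: "archimedean_generator \<psi>" and y: "0 < y" "y \<le> 1"
  shows "\<psi> (generator_inv \<psi> y) = y"
proof -
  obtain z where "0 \<le> z" "\<psi> z = y" using generator_surj[OF assms] .
  then show ?thesis
    using pseudo_inverse_generator[OF g, of z] y by (simp add: generator_inv_def)
qed

section \<open>The exponential generator and mixtures of generators\<close>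

lemma generator_exp: "archimedean_generator (\<lambda>z. exp (- z))"
proof -
  have "((\<lambda>z::real. exp (- z)) \<longlongrightarrow> 0) at_top"
    by (rule filterlim_compose[OF exp_at_bot filterlim_uminus_at_bot_at_top])
  then show ?thesis
    unfolding archimedean_generator_def monotone_on_def by (auto intro!: continuous_intros)
qed

text \<open>Where the mixture is nonzero, one of the two generators is positive and hence strictly
  decreasing there, while the other is non-increasing; positive weights preserve the strict
  drop.\<close>

lemma generator_convex_comb:
  assumes g: "archimedean_generator \<psi>\<^sub>1" "archimedean_generator \<psi>\<^sub>2" and p: "0 < p" "p < 1"
  shows "archimedean_generator (\<lambda>z. (1 - p) * \<psi>\<^sub>1 z + p * \<psi>\<^sub>2 z)"
proof -
  let ?\<Psi> = "\<lambda>z. (1 - p) * \<psi>\<^sub>1 z + p * \<psi>\<^sub>2 z"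
  have bounds: "0 \<le> ?\<Psi> z" "?\<Psi> z \<le> 1" if "0 \<le> z" for z
    using generator_bounds[OF g(1) that] generator_bounds[OF g(2) that] p
    by (auto intro!: convex_bound_le)
  have anti: "?\<Psi> z' \<le> ?\<Psi> z" if "0 \<le> z" "z \<le> z'" for z z'
    using generator_antimono[OF g(1) that] generator_antimono[OF g(2) that] p
    by (intro add_mono mult_left_mono) auto
  have strict: "?\<Psi> z' < ?\<Psi> z" if z: "0 \<le> z" "z < z'" and pos: "?\<Psi> z \<noteq> 0" for z z'
  proof -
    have "0 < \<psi>\<^sub>1 z \<or> 0 < \<psi>\<^sub>2 z"
      using pos generator_bounds[OF g(1) z(1)] generator_bounds[OF g(2) z(1)] by force
    then show ?thesis
    proof
      assume "0 < \<psi>\<^sub>1 z"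
      then have "\<psi>\<^sub>1 z' < \<psi>\<^sub>1 z" "\<psi>\<^sub>2 z' \<le> \<psi>\<^sub>2 z"
        using generator_strict[OF g(1) z] generator_antimono[OF g(2), of z z'] z by auto
      then show ?thesis using p by (intro add_less_le_mono mult_left_mono) auto
    next
      assume "0 < \<psi>\<^sub>2 z"
      then have "\<psi>\<^sub>2 z' < \<psi>\<^sub>2 z" "\<psi>\<^sub>1 z' \<le> \<psi>\<^sub>1 z"
        using generator_strict[OF g(2) z] generator_antimono[OF g(1), of z z'] z by auto
      then show ?thesis using p by (intro add_le_less_mono mult_left_mono) auto
    qed
  qed
  have lim: "(?\<Psi> \<longlongrightarrow> 0) at_top"
    using g by (auto simp: archimedean_generator_def intro!: tendsto_eq_intros)
  have cont: "continuous_on {0..} ?\<Psi>" "?\<Psi> 0 = 1"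
    using g by (auto simp: archimedean_generator_def intro!: continuous_intros)
  have "?\<Psi> z \<noteq> 0" if "0 \<le> z" "ennreal z < Inf (ennreal ` {x. 0 \<le> x \<and> ?\<Psi> x = 0})" for z
  proof
    assume "?\<Psi> z = 0"
    with that(1) have "Inf (ennreal ` {x. 0 \<le> x \<and> ?\<Psi> x = 0}) \<le> ennreal z"
      by (intro Inf_lower) auto
    with that(2) show False by simp
  qed
  then have "strict_antimono_on {z. 0 \<le> z \<and> ennreal z < Inf (ennreal ` {x. 0 \<le> x \<and> ?\<Psi> x = 0})} ?\<Psi>"
    using strict by (intro monotone_onI) auto
  then show ?thesis
    unfolding archimedean_generator_def using bounds anti lim cont
    by (auto intro!: monotone_onI)
qed

section \<open>Archimedean distribution functions\<close>

definition archimedean_function :: "(real \<Rightarrow> real) \<Rightarrow> (real ^ 'n) \<Rightarrow> real" where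
  "archimedean_function \<psi> x = generator_ext \<psi> (\<Sum>i\<in>UNIV. pseudo_inverse \<psi> (x $ i))"

text \<open>The summand of coordinate \<open>i\<close> alone already pushes the sum to the
  pseudo-inverse of 0.\<close>

lemma archimedean_function_eq_0:
  assumes g: "archimedean_generator \<psi>" and "x $ i = 0"
  shows "archimedean_function \<psi> x = 0"
  unfolding archimedean_function_def
proof (rule generator_ext_eq_0[OF g])
  show "pseudo_inverse \<psi> 0 \<le> (\<Sum>i\<in>UNIV. pseudo_inverse \<psi> (x $ i))"
    using assms(2) member_le_sum[of i UNIV "\<lambda>i. pseudo_inverse \<psi> (x $ i)"] by simp
qed

text \<open>At positive levels the pseudo-inverse recovers each \<open>z i\<close>. If some
  \<open>\<psi> (z i)\<close> is 0, then \<open>z i\<close> may be lost, but the sum is at least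
  \<open>z i\<close> and both sides vanish. Later computations use these coordinates
  \<open>z i\<close>.\<close>

lemma archimedean_function_generator:
  assumes g: "archimedean_generator \<psi>" and z: "\<And>i. 0 \<le> z i"
  shows "archimedean_function \<psi> (\<chi> i. \<psi> (z i)) = \<psi> (\<Sum>i\<in>UNIV. z i)"
proof (cases "\<exists>i. \<psi> (z i) = 0")
  case True
  then obtain i where i: "\<psi> (z i) = 0" by blast
  have "z i \<le> (\<Sum>i\<in>UNIV. z i)" using z by (intro member_le_sum) auto
  then have "\<psi> (\<Sum>i\<in>UNIV. z i) \<le> 0"
    using generator_antimono[OF g z] i by metis
  moreover have "0 \<le> \<psi> (\<Sum>i\<in>UNIV. z i)"
    using z by (intro generator_bounds[OF g] sum_nonneg)
  ultimately show ?thesis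
    using archimedean_function_eq_0[OF g, of "\<chi> i. \<psi> (z i)" i] i by simp
next
  case False
  then have "0 < \<psi> (z i)" for i
    using generator_bounds[OF g z] by (metis less_eq_real_def)
  then show ?thesis
    unfolding archimedean_function_def
    by (simp add: pseudo_inverse_generator[OF g z] sum_ennreal z sum_nonneg)
qed

lemma archimedean_function_pos:
  assumes g: "archimedean_generator \<psi>" and x: "\<And>i. 0 < x $ i" "\<And>i. x $ i \<le> 1"
  shows "archimedean_function \<psi> x = \<psi> (\<Sum>i\<in>UNIV. generator_inv \<psi> (x $ i))"
  using archimedean_function_generator[OF g, of "\<lambda>i. generator_inv \<psi> (x $ i)"]
  by (simp only: generator_inv[OF g x] vec_nth_inverse generator_inv_nonneg)

section \<open>Null sets and measurability for measures on the cube\<close>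

lemma AE_cube_measure:
  assumes M: "cube_measure_with_df C M"
  shows "AE x in M. \<forall>i. 0 \<le> x $ i \<and> x $ i \<le> 1"
proof -
  interpret prob_space M using M by (simp add: cube_measure_with_df_def)
  have "AE x in M. x \<in> {0..1}"
    by (rule AE_prob_1) (use M in \<open>simp add: cube_measure_with_df_def\<close>)
  then show ?thesis by (rule AE_mp) (simp add: less_eq_vec_def)
qed

lemma measure_eq_df:
  assumes M: "cube_measure_with_df C M" and "x \<in> {0..1}" "A \<in> sets borel"
    and "AE y in M. y \<in> A \<longleftrightarrow> (\<forall>i. y $ i \<le> x $ i)"
  shows "measure M A = C x"
proof -
  have "measure M A = measure M {..x}"
    using assms by (intro measure_eq_AE) (auto simp: cube_measure_with_df_def less_eq_vec_def)
  then show ?thesis using assms by (simp add: cube_measure_with_df_def)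
qed

lemma borel_measurable_vec_nth [measurable (raw)]:
  fixes f :: "'a \<Rightarrow> real ^ 'n"
  assumes "f \<in> borel_measurable M"
  shows "(\<lambda>x. f x $ i) \<in> borel_measurable M"
  using assms by (rule measurable_compose) (intro borel_measurable_continuous_onI continuous_intros)

text \<open>Up to a null set, the face of coordinate \<open>i\<close> at 0 is the orthant below the
  point with \<open>i\<close>-th coordinate 0 and all others 1, where \<open>C\<close> vanishes. So
  \<open>generator_inv\<close> is almost surely applied only where it is a true inverse.\<close>

lemma AE_cube_measure_pos:
  assumes M: "cube_measure_with_df C M" and g: "archimedean_generator \<psi>"
    and C: "\<forall>x\<in>{0..1}. C x = archimedean_function \<psi> x"
  shows "AE x in M. \<forall>i. 0 < x $ i \<and> x $ i \<le> 1"
proof -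
  interpret prob_space M using M by (simp add: cube_measure_with_df_def)
  have sets: "sets M = sets borel" using M by (simp add: cube_measure_with_df_def)
  have "AE x in M. 0 < x $ i" for i
  proof -
    let ?x = "\<chi> j. if j = i then (0 :: real) else 1"
    have "measure M {y. y $ i \<le> 0} = C ?x"
    proof (rule measure_eq_df[OF M])
      show "AE y in M. y \<in> {y. y $ i \<le> 0} \<longleftrightarrow> (\<forall>j. y $ j \<le> ?x $ j)"
        using AE_cube_measure[OF M] by eventually_elim auto
    qed (simp_all add: less_eq_vec_def)
    also have "\<dots> = 0"
      using archimedean_function_eq_0[OF g, of ?x i] by (subst C[rule_format]) (auto simp: less_eq_vec_def)
    finally have "{y. y $ i \<le> 0} \<in> null_sets M"
      by (auto simp: null_sets_def emeasure_eq_measure sets)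
    then show ?thesis by (rule AE_I') (auto simp: not_less)
  qed
  then have "AE x in M. \<forall>i. 0 < x $ i"
    by (simp add: AE_all_countable)
  with AE_cube_measure[OF M] show ?thesis by eventually_elim auto
qed

section \<open>Convex combinations of generators\<close>

text \<open>The distribution function \<open>archimedean_function \<psi>\<close> belongs to the law of
  \<open>(\<psi> Z\<^sub>1, \<dots>, \<psi> Z\<^sub>d)\<close> where \<open>P (Z\<^sub>1 \<ge> z\<^sub>1, \<dots>, Z\<^sub>d \<ge> z\<^sub>d) = \<psi> (z\<^sub>1 + \<dots> + z\<^sub>d)\<close>. The map below turns
  \<open>\<psi> Z\<^sub>i\<close> into \<open>\<Psi> Z\<^sub>i\<close>; the clamping outside \<open>(0, 1]\<close> makes it monotone on the whole line.\<close>

definition generator_change :: "(real \<Rightarrow> real) \<Rightarrow> (real \<Rightarrow> real) \<Rightarrow> real \<Rightarrow> real" where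
  "generator_change \<psi> \<Psi> x = (if x \<le> 0 then 0 else if 1 < x then 1 else \<Psi> (generator_inv \<psi> x))"

definition generator_change_vec :: "(real \<Rightarrow> real) \<Rightarrow> (real \<Rightarrow> real) \<Rightarrow> (real ^ 'n) \<Rightarrow> (real ^ 'n)" where
  "generator_change_vec \<psi> \<Psi> x = (\<chi> i. generator_change \<psi> \<Psi> (x $ i))"

context
  fixes \<psi> \<Psi> :: "real \<Rightarrow> real"
  assumes \<psi>: "archimedean_generator \<psi>" and \<Psi>: "archimedean_generator \<Psi>"
begin

lemma generator_change_bounds: "0 \<le> generator_change \<psi> \<Psi> x" "generator_change \<psi> \<Psi> x \<le> 1"
  using generator_bounds[OF \<Psi>] by (auto simp: generator_change_def)

text \<open>On \<open>(0, 1]\<close> the map composes two decreasing functions. Monotonicity is what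
  gives Borel measurability below.\<close>

lemma mono_generator_change: "mono (generator_change \<psi> \<Psi>)"
proof (rule monoI)
  fix x y :: real
  assume xy: "x \<le> y"
  consider "x \<le> 0" | "1 < y" | "0 < x" "y \<le> 1" by linarith
  then show "generator_change \<psi> \<Psi> x \<le> generator_change \<psi> \<Psi> y"
  proof cases
    case 1
    then show ?thesis using generator_change_bounds[of y] by (simp add: generator_change_def)
  next
    case 2
    then show ?thesis using generator_change_bounds[of x] by (simp add: generator_change_def)
  next
    case 3
    have "generator_inv \<psi> y \<le> generator_inv \<psi> x"
      using generator_le_iff[OF \<psi>, of "generator_inv \<psi> x" "generator_inv \<psi> y"] 3 xy
      by (simp add: generator_inv[OF \<psi>])
    then show ?thesis
      using 3 xy by (simp add: generator_change_def generator_antimono[OF \<Psi>])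
  qed
qed

text \<open>Both inequalities say \<open>z \<le> t\<close> for the argument \<open>t\<close> with
  \<open>\<psi> t = x\<close>: \<open>\<psi>\<close> is positive at \<open>t\<close>, and if
  \<open>t < z\<close> then \<open>\<Psi> t \<ge> \<Psi> z > 0\<close>, so each generator drops
  strictly after \<open>t\<close>.\<close>

lemma generator_change_le_iff:
  assumes "0 < x" "x \<le> 1" "0 \<le> z" "0 < \<Psi> z"
  shows "generator_change \<psi> \<Psi> x \<le> \<Psi> z \<longleftrightarrow> x \<le> \<psi> z"
proof -
  let ?t = "generator_inv \<psi> x"
  have "\<Psi> ?t \<le> \<Psi> z \<longleftrightarrow> z \<le> ?t"
    using assms generator_antimono[OF \<Psi>, of z ?t] generator_strict[OF \<Psi>, of ?t z] generator_antimono[OF \<Psi>, of ?t z]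
    by (cases "z \<le> ?t") auto
  also have "\<dots> \<longleftrightarrow> \<psi> ?t \<le> \<psi> z"
    using generator_le_iff[OF \<psi>, of ?t z] assms by (simp add: generator_inv[OF \<psi>])
  finally show ?thesis
    using assms by (simp add: generator_inv[OF \<psi>] generator_change_def)
qed

lemma generator_change_vec_measurable [measurable]:
  "generator_change_vec \<psi> \<Psi> \<in> borel_measurable (borel :: (real ^ 'n) measure)"
proof -
  have "(\<lambda>x :: real ^ 'n. generator_change \<psi> \<Psi> (x $ i)) \<in> borel_measurable borel" for i
    by (rule measurable_compose[OF _ borel_measurable_mono[OF mono_generator_change]]) measurable
  then show ?thesis
    by (subst borel_measurable_euclidean_space)
      (auto simp: Basis_vec_def inner_axis generator_change_vec_def)
qed

lemma generator_change_vec_cube: "generator_change_vec \<psi> \<Psi> x \<in> {0..1}"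
  using generator_change_bounds by (auto simp: generator_change_vec_def less_eq_vec_def)

text \<open>Up to a null set, the orthant below the point with coordinates
  \<open>\<Psi> (z i)\<close> pulls back to the orthant below the point with coordinates
  \<open>\<psi> (z i)\<close>. The result is linear in \<open>\<psi>\<close>, which makes mixing
  possible.\<close>

lemma measure_generator_change:
  fixes C :: "(real ^ 'n) \<Rightarrow> real"
  assumes M: "cube_measure_with_df C M" and C: "\<forall>x\<in>{0..1}. C x = archimedean_function \<psi> x"
    and z: "\<And>i. 0 \<le> z i" "\<And>i. 0 < \<Psi> (z i)"
  shows "measure M (generator_change_vec \<psi> \<Psi> -` {..\<chi> i. \<Psi> (z i)}) = \<psi> (\<Sum>i\<in>UNIV. z i)"
proof -
  let ?A = "generator_change_vec \<psi> \<Psi> -` {..\<chi> i. \<Psi> (z i)} :: (real ^ 'n) set"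
  have cube: "(\<chi> i. \<psi> (z i)) \<in> {0..1::real ^ 'n}"
    using generator_bounds[OF \<psi> z(1)] by (auto simp: less_eq_vec_def)
  have "measure M ?A = C (\<chi> i. \<psi> (z i))"
  proof (rule measure_eq_df[OF M cube])
    show "?A \<in> sets borel"
      using measurable_sets[OF generator_change_vec_measurable, of "{..\<chi> i. \<Psi> (z i)}"] by simp
    show "AE y in M. y \<in> ?A \<longleftrightarrow> (\<forall>i. y $ i \<le> (\<chi> i. \<psi> (z i)) $ i)"
      using AE_cube_measure_pos[OF M \<psi> C]
      by eventually_elim (auto simp: less_eq_vec_def generator_change_vec_def generator_change_le_iff z)
  qed
  also have "\<dots> = \<psi> (\<Sum>i\<in>UNIV. z i)"
    using C[rule_format, OF cube] archimedean_function_generator[OF \<psi> z(1)] by simp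
  finally show ?thesis .
qed

end

section \<open>Mixtures of measures, realised by a biased coin that selects the measure to sample
  from\<close>

lemma measure_convex_comb_bind:
  assumes M: "prob_space M\<^sub>1" "sets M\<^sub>1 = sets borel" "prob_space M\<^sub>2" "sets M\<^sub>2 = sets borel"
    and p: "0 \<le> p" "p \<le> 1"
  defines "N \<equiv> measure_pmf (bernoulli_pmf p) \<bind> (\<lambda>b. if b then M\<^sub>2 else M\<^sub>1)"
  shows "prob_space N" "sets N = sets borel"
    "A \<in> sets borel \<Longrightarrow> measure N A = (1 - p) * measure M\<^sub>1 A + p * measure M\<^sub>2 A"
proof -
  interpret M\<^sub>1: prob_space M\<^sub>1 by fact
  interpret M\<^sub>2: prob_space M\<^sub>2 by fact
  have K: "(\<lambda>b. if b then M\<^sub>2 else M\<^sub>1) \<in> measurable (measure_pmf (bernoulli_pmf p)) (subprob_algebra borel)"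
    using M by (auto simp: measurable_def space_subprob_algebra prob_space_imp_subprob_space)
  show N: "prob_space N"
    unfolding N_def using M by (intro prob_space.prob_space_bind[OF prob_space_measure_pmf _ K]) auto
  then interpret N: prob_space N .
  show "sets N = sets borel"
    unfolding N_def using M by (intro sets_bind) auto
  assume "A \<in> sets borel"
  then have "emeasure N A = emeasure M\<^sub>2 A * ennreal p + emeasure M\<^sub>1 A * ennreal (1 - p)"
    unfolding N_def using p by (subst emeasure_bind[OF _ K]) auto
  also have "\<dots> = ennreal ((1 - p) * measure M\<^sub>1 A + p * measure M\<^sub>2 A)"
    using p by (simp add: M\<^sub>1.emeasure_eq_measure M\<^sub>2.emeasure_eq_measure mult.commute add.commute
        flip: ennreal_mult ennreal_plus)
  finally show "measure N A = (1 - p) * measure M\<^sub>1 A + p * measure M\<^sub>2 A"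
    using p by (simp add: N.emeasure_eq_measure del: ennreal_plus)
qed

text \<open>At coordinates \<open>\<Psi> (z i)\<close> the two image measures have as distribution
  functions \<open>\<psi>\<^sub>1\<close> and \<open>\<psi>\<^sub>2\<close> of the same sum, so the
  mixture has \<open>\<Psi>\<close> of that sum. The mass formula is kept in the conclusion because
  its second term later bounds the mass of a box from below.\<close>

lemma cube_measure_convex_comb:
  fixes C\<^sub>1 C\<^sub>2 :: "(real ^ 'n) \<Rightarrow> real"
  assumes g: "archimedean_generator \<psi>\<^sub>1" "archimedean_generator \<psi>\<^sub>2"
    and M\<^sub>1: "cube_measure_with_df C\<^sub>1 M\<^sub>1" and C\<^sub>1: "\<forall>x\<in>{0..1}. C\<^sub>1 x = archimedean_function \<psi>\<^sub>1 x"
    and M\<^sub>2: "cube_measure_with_df C\<^sub>2 M\<^sub>2" and C\<^sub>2: "\<forall>x\<in>{0..1}. C\<^sub>2 x = archimedean_function \<psi>\<^sub>2 x"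
    and p: "0 < p" "p < 1"
  defines "\<Psi> \<equiv> \<lambda>z. (1 - p) * \<psi>\<^sub>1 z + p * \<psi>\<^sub>2 z"
  obtains N where "cube_measure_with_df (archimedean_function \<Psi>) N"
    "\<forall>A\<in>sets borel. measure N A = (1 - p) * measure M\<^sub>1 (generator_change_vec \<psi>\<^sub>1 \<Psi> -` A)
        + p * measure M\<^sub>2 (generator_change_vec \<psi>\<^sub>2 \<Psi> -` A)"
proof -
  have \<Psi>: "archimedean_generator \<Psi>"
    unfolding \<Psi>_def by (rule generator_convex_comb[OF g p])
  let ?T\<^sub>1 = "generator_change_vec \<psi>\<^sub>1 \<Psi> :: real ^ 'n \<Rightarrow> real ^ 'n"
  let ?T\<^sub>2 = "generator_change_vec \<psi>\<^sub>2 \<Psi> :: real ^ 'n \<Rightarrow> real ^ 'n"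
  have prob: "prob_space M\<^sub>1" "prob_space M\<^sub>2" and sets: "sets M\<^sub>1 = sets borel" "sets M\<^sub>2 = sets borel"
    using M\<^sub>1 M\<^sub>2 by (auto simp: cube_measure_with_df_def)
  interpret M\<^sub>1: prob_space M\<^sub>1 by (rule prob)
  interpret M\<^sub>2: prob_space M\<^sub>2 by (rule prob)
  have T [measurable]: "?T\<^sub>1 \<in> measurable M\<^sub>1 borel" "?T\<^sub>2 \<in> measurable M\<^sub>2 borel"
    using generator_change_vec_measurable[OF g(1) \<Psi>] generator_change_vec_measurable[OF g(2) \<Psi>] sets
    by (simp_all cong: measurable_cong_sets)
  have space: "space M\<^sub>1 = UNIV" "space M\<^sub>2 = UNIV"
    using sets_eq_imp_space_eq[OF sets(1)] sets_eq_imp_space_eq[OF sets(2)] by simp_all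
  let ?D\<^sub>1 = "distr M\<^sub>1 borel ?T\<^sub>1" and ?D\<^sub>2 = "distr M\<^sub>2 borel ?T\<^sub>2"
  define N where "N = measure_pmf (bernoulli_pmf p) \<bind> (\<lambda>b. if b then ?D\<^sub>2 else ?D\<^sub>1)"
  have D: "prob_space ?D\<^sub>1" "sets ?D\<^sub>1 = sets borel" "prob_space ?D\<^sub>2" "sets ?D\<^sub>2 = sets borel"
    by (rule M\<^sub>1.prob_space_distr[OF T(1)], rule sets_distr,
        rule M\<^sub>2.prob_space_distr[OF T(2)], rule sets_distr)
  have N: "prob_space N" "sets N = sets borel"
    using measure_convex_comb_bind(1,2)[OF D, of p] p by (auto simp: N_def)
  have N': "measure N A = (1 - p) * measure ?D\<^sub>1 A + p * measure ?D\<^sub>2 A" if "A \<in> sets borel" for A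
    using measure_convex_comb_bind(3)[OF D, of p] p that by (auto simp: N_def)
  have meas: "measure N A = (1 - p) * measure M\<^sub>1 (?T\<^sub>1 -` A) + p * measure M\<^sub>2 (?T\<^sub>2 -` A)"
    if "A \<in> sets borel" for A
    unfolding N'[OF that] measure_distr[OF T(1) that] measure_distr[OF T(2) that] space by simp
  have "?T\<^sub>1 -` {0..1} = UNIV" "?T\<^sub>2 -` {0..1} = UNIV"
    using generator_change_vec_cube[OF g(1) \<Psi>] generator_change_vec_cube[OF g(2) \<Psi>]
    unfolding vimage_def by blast+
  then have cube: "measure N {0..1} = 1"
    using meas[of "{0..1}"] M\<^sub>1.prob_space M\<^sub>2.prob_space space by simp
  have "measure N {..x} = archimedean_function \<Psi> x" if x: "x \<in> {0..1}" for x
  proof (cases "\<exists>i. x $ i = 0")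
    case True
    then obtain i where i: "x $ i = 0" ..
    \<comment> \<open>A zero coordinate of \<open>x\<close> need not be a value of
      \<open>\<Psi>\<close> at a real argument. Instead the preimage is shown to be null: almost
      every point has positive coordinates, and the change of generator keeps them positive.\<close>
    have null: "measure M (generator_change_vec \<psi> \<Psi> -` {..x}) = 0"
      if M: "cube_measure_with_df C M" and \<psi>: "archimedean_generator \<psi>"
        and C: "\<forall>x\<in>{0..1}. C x = archimedean_function \<psi> x" 
        and pos: "\<And>z. 0 \<le> z \<Longrightarrow> 0 < \<psi> z \<Longrightarrow> 0 < \<Psi> z"
      for M :: "(real ^ 'n) measure" and C \<psi>
    proof -
      have "AE y in M. y \<notin> generator_change_vec \<psi> \<Psi> -` {..x}"
        using AE_cube_measure_pos[OF M \<psi> C]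
      proof eventually_elim
        case (elim y)
        then have "0 < \<psi> (generator_inv \<psi> (y $ i))"
          using generator_inv[OF \<psi>] by simp
        then have "0 < \<Psi> (generator_inv \<psi> (y $ i))"
          by (rule pos[OF generator_inv_nonneg])
        then have "0 < generator_change_vec \<psi> \<Psi> y $ i"
          using elim by (simp add: generator_change_vec_def generator_change_def not_le)
        then have "\<not> generator_change_vec \<psi> \<Psi> y \<le> x"
          using i unfolding less_eq_vec_def by (metis not_le)
        then show ?case by simp
      qed
      moreover have "generator_change_vec \<psi> \<Psi> -` {..x} \<in> sets M"
        using measurable_sets[OF generator_change_vec_measurable[OF \<psi> \<Psi>], of "{..x}"] M
        by (simp add: cube_measure_with_df_def)
      ultimately have "generator_change_vec \<psi> \<Psi> -` {..x} \<in> null_sets M"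
        by (subst AE_iff_null_sets)
      then show ?thesis by (simp add: measure_def null_sets_def)
    qed
    have "0 < \<Psi> z" if "0 \<le> z" "0 < \<psi>\<^sub>1 z \<or> 0 < \<psi>\<^sub>2 z" for z
    proof -
      have "0 \<le> (1 - p) * \<psi>\<^sub>1 z" "0 \<le> p * \<psi>\<^sub>2 z"
        using generator_bounds[OF g(1) that(1)] generator_bounds[OF g(2) that(1)] p by simp_all
      moreover have "0 < (1 - p) * \<psi>\<^sub>1 z \<or> 0 < p * \<psi>\<^sub>2 z"
        using that(2) mult_pos_pos[of "1 - p" "\<psi>\<^sub>1 z"] mult_pos_pos[of p "\<psi>\<^sub>2 z"] p by linarith
      ultimately show ?thesis unfolding \<Psi>_def by linarith
    qed
    then show ?thesis
      using meas[of "{..x}"] null[OF M\<^sub>1 g(1) C\<^sub>1] null[OF M\<^sub>2 g(2) C\<^sub>2] archimedean_function_eq_0[OF \<Psi> i] by simp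
  next
    case False
    then have pos: "0 < x $ i" and le: "x $ i \<le> 1" for i
      using x by (auto simp: less_eq_vec_def less_le)
    define z where "z i = generator_inv \<Psi> (x $ i)" for i
    have z: "0 \<le> z i" "\<Psi> (z i) = x $ i" for i
      using generator_inv[OF \<Psi> pos le] by (auto simp: z_def)
    then have zpos: "0 < \<Psi> (z i)" for i using pos by simp
    have "(\<chi> i. \<Psi> (z i)) = x" using z by (simp add: vec_eq_iff)
    then have "measure M\<^sub>1 (?T\<^sub>1 -` {..x}) = \<psi>\<^sub>1 (\<Sum>i\<in>UNIV. z i)"
      "measure M\<^sub>2 (?T\<^sub>2 -` {..x}) = \<psi>\<^sub>2 (\<Sum>i\<in>UNIV. z i)"
      "archimedean_function \<Psi> x = \<Psi> (\<Sum>i\<in>UNIV. z i)"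
      using measure_generator_change[OF g(1) \<Psi> M\<^sub>1 C\<^sub>1 z(1) zpos]
        measure_generator_change[OF g(2) \<Psi> M\<^sub>2 C\<^sub>2 z(1) zpos]
        archimedean_function_generator[OF \<Psi> z(1)] by auto
    then show ?thesis using meas[of "{..x}"] by (simp add: \<Psi>_def)
  qed
  then have "cube_measure_with_df (archimedean_function \<Psi>) N"
    using N cube by (simp add: cube_measure_with_df_def)
  then show thesis using meas by (intro that) auto
qed

section \<open>The independence copula\<close>

lemma measure_lborel_cube:
  assumes "\<And>i. a $ i \<le> (b :: real ^ 'n) $ i"
  shows "measure lborel (cbox a b) = (\<Prod>i\<in>UNIV. b $ i - a $ i)"
proof -
  have "cbox a b \<noteq> {}" using assms by (simp add: interval_ne_empty_cart)
  then show ?thesis by (rule content_cbox_cart)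
qed

lemma emeasure_lborel_unit_cube: "emeasure lborel {0..1 :: real ^ 'n} = 1"
  using measure_lborel_cube[of 0 "1 :: real ^ 'n"] emeasure_lborel_cbox_finite[of 0 "1 :: real ^ 'n"]
  by (simp add: interval_cbox_cart emeasure_eq_ennreal_measure)

lemma measure_uniform_unit_cube:
  assumes "A \<in> sets borel"
  shows "measure (uniform_measure lborel {0..1 :: real ^ 'n}) A = measure lborel ({0..1} \<inter> A)"
  using emeasure_lborel_unit_cube[where 'n = 'n] assms by (subst measure_uniform_measure) (auto simp: measure_def)

lemma cube_measure_independence:
  "cube_measure_with_df (\<lambda>x. \<Prod>i\<in>UNIV. x $ i) (uniform_measure lborel {0..1 :: real ^ 'n})"
  unfolding cube_measure_with_df_def
proof (intro conjI ballI)
  show "prob_space (uniform_measure lborel {0..1 :: real ^ 'n})"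
    using emeasure_lborel_unit_cube[where 'n = 'n] by (intro prob_space_uniform_measure) auto
  show "measure (uniform_measure lborel {0..1 :: real ^ 'n}) {0..1} = 1"
    using emeasure_lborel_unit_cube[where 'n = 'n] by (subst measure_uniform_unit_cube) (auto simp: measure_def)
  fix x :: "real ^ 'n" assume x: "x \<in> {0..1}"
  then have "{0..1} \<inter> {..x} = cbox 0 x"
    by (auto simp: interval_cbox_cart[symmetric] intro: order_trans)
  then show "measure (uniform_measure lborel {0..1}) {..x} = (\<Prod>i\<in>UNIV. x $ i)"
    using x measure_lborel_cube[of 0 x] by (subst measure_uniform_unit_cube) (auto simp: less_eq_vec_def)
qed simp

text \<open>The exponential turns the sum of inverses into a product; a zero coordinate, whose
  inverse is infinite, is treated apart.\<close>

lemma archimedean_function_exp: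
  assumes "x \<in> {0..1}"
  shows "archimedean_function (\<lambda>z. exp (- z)) x = (\<Prod>i\<in>UNIV. x $ i)"
proof (cases "\<exists>i. x $ i = 0")
  case True
  then show ?thesis using archimedean_function_eq_0[OF generator_exp] by (metis finite prod_zero UNIV_I)
next
  case False
  then have "0 < x $ i" "x $ i \<le> 1" for i
    using assms by (auto simp: less_eq_vec_def less_le)
  then show ?thesis
    using generator_inv[OF generator_exp] 
    by (simp add: archimedean_function_pos[OF generator_exp] exp_sum flip: sum_negf)
qed

section \<open>Archimedean copulas\<close>

lemma generator_inv_1:
  assumes "archimedean_generator \<psi>"
  shows "generator_inv \<psi> 1 = 0"
  using pseudo_inverse_generator[OF assms, of 0] assms
  by (simp add: generator_inv_def archimedean_generator_def)

text \<open>The inverse of 1 is 0, so coordinates equal to 1 drop out of the sum.\<close>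

lemma archimedean_function_margin:
  assumes g: "archimedean_generator \<psi>" and t: "0 \<le> t" "t \<le> 1"
  shows "archimedean_function \<psi> (\<chi> j. if j = i then t else 1) = t"
proof (cases "t = 0")
  case True
  then show ?thesis
    using archimedean_function_eq_0[OF g, of "\<chi> j. if j = i then t else 1" i] by simp
next
  case False
  then have t0: "0 < t" using t by simp
  have "archimedean_function \<psi> (\<chi> j. if j = i then t else 1)
      = \<psi> (\<Sum>j\<in>UNIV. if j = i then generator_inv \<psi> t else 0)"
    using t t0 by (subst archimedean_function_pos[OF g])
      (auto simp: generator_inv_1[OF g] if_distrib[of "generator_inv \<psi>"] cong: if_cong)
  also have "\<dots> = t" using generator_inv[OF g t0 t(2)] by simp
  finally show ?thesis .
qed

lemma cdf_uniform_01:
  fixes t :: real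
  shows "measure (uniform_measure lborel {0..1}) {..t} = min 1 (max 0 t)"
proof -
  have "{0..1} \<inter> {..t} = (if t < 0 then {} else {0..min 1 t})" by auto
  then show ?thesis by (auto simp: measure_uniform_measure min_def max_def)
qed

text \<open>Uniform margins follow from the Archimedean form by comparing distribution functions on
  the line, so any cube measure with such a distribution function yields a copula.\<close>

lemma margin_archimedean:
  assumes M: "cube_measure_with_df C M" and g: "archimedean_generator \<psi>"
    and C: "\<forall>x\<in>{0..1}. C x = archimedean_function \<psi> x"
  shows "distr M borel (\<lambda>x. x $ i) = uniform_measure lborel {0..1}"
proof (rule cdf_unique)
  interpret prob_space M using M by (simp add: cube_measure_with_df_def)
  have sets [measurable_cong]: "sets M = sets borel" using M by (simp add: cube_measure_with_df_def)
  then have space: "space M = UNIV" using sets_eq_imp_space_eq by fastforce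
  have nth: "(\<lambda>x. x $ i) \<in> borel_measurable M" by measurable
  then show "real_distribution (distr M borel (\<lambda>x. x $ i))"
    by (rule real_distribution_distr)
  have "prob_space (uniform_measure lborel {0..1::real})"
    by (rule prob_space_uniform_measure) auto
  then show "real_distribution (uniform_measure lborel {0..1})"
    by (simp add: real_distribution_def real_distribution_axioms_def)
  have "measure M {x. x $ i \<le> t} = min 1 (max 0 t)" for t
  proof -
    \<comment> \<open>Clamping makes \<open>t > 1\<close> the almost sure event;
      \<open>t < 0\<close> is handled separately as a null event.\<close>
    let ?s = "min 1 (max 0 t)"
    let ?x = "\<chi> j. if j = i then ?s else 1"
    have cube: "?x \<in> {0..1}" by (auto simp: less_eq_vec_def)
    show ?thesis
    proof (cases "0 \<le> t")
      case True
      have "measure M {x. x $ i \<le> t} = C ?x"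
      proof (rule measure_eq_df[OF M cube])
        show "AE y in M. y \<in> {x. x $ i \<le> t} \<longleftrightarrow> (\<forall>j. y $ j \<le> ?x $ j)"
          using AE_cube_measure[OF M] by eventually_elim (use True in auto)
      qed measurable
      also have "\<dots> = ?s"
        using C[rule_format, OF cube] archimedean_function_margin[OF g, of ?s i] by simp
      finally show ?thesis .
    next
      case False
      have "measure M {x. x $ i \<le> t} = measure M {}"
      proof (rule measure_eq_AE)
        show "AE y in M. y \<in> {x. x $ i \<le> t} \<longleftrightarrow> y \<in> {}"
          using AE_cube_measure[OF M]
        proof eventually_elim
          case (elim y)
          then have "0 \<le> y $ i" by blast
          then show ?case using False by simp
        qed
      qed measurable
      then show ?thesis using False by simp
    qed
  qed
  then show "cdf (distr M borel (\<lambda>x. x $ i)) = cdf (uniform_measure lborel {0..1})"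
    using nth by (auto simp: fun_eq_iff cdf_def cdf_uniform_01 measure_distr space vimage_def)
qed

lemma archimedean_copulaI:
  assumes M: "cube_measure_with_df (archimedean_function \<psi>) M" and g: "archimedean_generator \<psi>"
  defines "C \<equiv> restrict (archimedean_function \<psi>) {0..1}"
  shows "C \<in> archimedean_copulas" "copula_measure C = M"
proof -
  have CM: "cube_measure_with_df C M"
    using M by (simp add: C_def cube_measure_with_df_def)
  have C: "\<forall>x\<in>{0..1}. C x = archimedean_function \<psi> x" by (simp add: C_def)
  have "C \<in> copulas"
    unfolding copulas_def using CM margin_archimedean[OF CM g C] by (auto simp: C_def)
  then show "C \<in> archimedean_copulas"
    unfolding archimedean_copulas_def using g by (auto simp: C_def archimedean_function_def)
  show "copula_measure C = M"
    using cube_measure_with_df_copula_measure[OF \<open>C \<in> copulas\<close>] CM by (rule cube_measure_with_df_unique)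
qed

lemma archimedean_copulaE:
  assumes "C \<in> archimedean_copulas"
  obtains \<psi> where "archimedean_generator \<psi>" "\<forall>x\<in>{0..1}. C x = archimedean_function \<psi> x"
    "cube_measure_with_df C (copula_measure C)"
  using assms cube_measure_with_df_copula_measure
  unfolding archimedean_copulas_def archimedean_function_def by blast

text \<open>The increment is at most the mass of the points below \<open>x\<close> but not below
  \<open>y\<close>. These lie in the union of the strips between \<open>y $ i\<close> and
  \<open>x $ i\<close>, and uniform margins bound each strip by its width.\<close>

lemma archimedean_copula_lipschitz:
  fixes C :: "(real ^ 'n) \<Rightarrow> real"
  assumes C: "C \<in> archimedean_copulas" and xy: "x \<in> {0..1}" "y \<in> {0..1}"
  shows "\<bar>C x - C y\<bar> \<le> (\<Sum>i\<in>UNIV. \<bar>x $ i - y $ i\<bar>)"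
proof -
  obtain \<psi> where g: "archimedean_generator \<psi>" and C: "\<forall>x\<in>{0..1}. C x = archimedean_function \<psi> x"
    and M: "cube_measure_with_df C (copula_measure C)" using archimedean_copulaE[OF C] .
  define M where "M = copula_measure C"
  note M = M[folded M_def]
  interpret prob_space M using M by (simp add: cube_measure_with_df_def)
  have sets [measurable_cong]: "sets M = sets borel" using M by (simp add: cube_measure_with_df_def)
  then have space: "space M = UNIV" using sets_eq_imp_space_eq by fastforce
  \<comment> \<open>The absolute value also covers \<open>b < a\<close>, when the strip is
    empty.\<close>
  have strip: "measure M {u. a < u $ i \<and> u $ i \<le> b} \<le> \<bar>b - a\<bar>" for a b i
  proof -
    have nth: "(\<lambda>x. x $ i) \<in> borel_measurable M" by measurable
    have "measure M {u. a < u $ i \<and> u $ i \<le> b} = measure (distr M borel (\<lambda>x. x $ i)) {a<..b}"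
      using nth by (simp add: measure_distr space vimage_def)
    also have "\<dots> = measure lborel ({0..1} \<inter> {a<..b})"
      unfolding margin_archimedean[OF M g C] by (subst measure_uniform_measure) auto
    also have "\<dots> \<le> measure lborel {a..b}"
    proof (rule measure_mono_fmeasurable)
      show "{a..b} \<in> fmeasurable lborel"
        by (rule fmeasurableI) (simp_all add: emeasure_lborel_Icc_eq)
    qed auto
    also have "\<dots> \<le> \<bar>b - a\<bar>" by (cases "a \<le> b") simp_all
    finally show ?thesis .
  qed
  have *: "C x - C y \<le> (\<Sum>i\<in>UNIV. \<bar>x $ i - y $ i\<bar>)" if "x \<in> {0..1}" "y \<in> {0..1}" for x y
  proof -
    have "C x - C y = measure M {..x} - measure M {..y}"
      using M that by (simp add: cube_measure_with_df_def)
    also have "\<dots> \<le> measure M ({..x} - {..y})"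
      using finite_measure_Diff'[of "{..x}" "{..y}"] finite_measure_mono[of "{..x} \<inter> {..y}" "{..y}"] sets by simp
    also have "\<dots> \<le> measure M (\<Union>i\<in>UNIV. {u. y $ i < u $ i \<and> u $ i \<le> x $ i})"
    proof (rule finite_measure_mono)
      show "{..x} - {..y} \<subseteq> (\<Union>i\<in>UNIV. {u. y $ i < u $ i \<and> u $ i \<le> x $ i})"
        unfolding less_eq_vec_def atMost_def by (auto simp: not_le)
    qed auto
    also have "\<dots> \<le> (\<Sum>i\<in>UNIV. measure M {u. y $ i < u $ i \<and> u $ i \<le> x $ i})"
      by (rule finite_measure_subadditive_finite) auto
    also have "\<dots> \<le> (\<Sum>i\<in>UNIV. \<bar>x $ i - y $ i\<bar>)"
      by (rule sum_mono) (rule strip)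
    finally show ?thesis .
  qed
  show ?thesis
    using *[OF xy] *[OF xy(2) xy(1)] by (simp add: abs_le_iff abs_minus_commute)
qed

lemma archimedean_convex_comb_close:
  fixes C :: "(real ^ 'n) \<Rightarrow> real" and p :: real
  assumes C: "C \<in> archimedean_copulas" and C_eq: "\<forall>x\<in>{0..1}. C x = archimedean_function \<psi>\<^sub>1 x"
    and g: "archimedean_generator \<psi>\<^sub>1" "archimedean_generator \<psi>\<^sub>2" and p: "0 < p" "p < 1" and x: "x \<in> {0..1}"
  defines "\<Psi> \<equiv> \<lambda>z. (1 - p) * \<psi>\<^sub>1 z + p * \<psi>\<^sub>2 z"
  shows "\<bar>archimedean_function \<Psi> x - C x\<bar> \<le> (real CARD('n) + 1) * p"
proof -
  have \<Psi>: "archimedean_generator \<Psi>"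
    unfolding \<Psi>_def by (rule generator_convex_comb[OF g p])
  have close: "\<bar>\<Psi> z - \<psi>\<^sub>1 z\<bar> \<le> p" if "0 \<le> z" for z
  proof -
    have "\<Psi> z - \<psi>\<^sub>1 z = p * (\<psi>\<^sub>2 z - \<psi>\<^sub>1 z)" by (simp add: \<Psi>_def algebra_simps)
    moreover have "\<bar>\<psi>\<^sub>2 z - \<psi>\<^sub>1 z\<bar> \<le> 1"
      using generator_bounds[OF g(1) that] generator_bounds[OF g(2) that] by linarith
    ultimately show ?thesis using p by (simp add: abs_mult mult_left_le)
  qed
  show ?thesis
  proof (cases "\<exists>i. x $ i = 0")
    case True
    then obtain i where "x $ i = 0" ..
    then show ?thesis
      using archimedean_function_eq_0[OF g(1), of x i] archimedean_function_eq_0[OF \<Psi>, of x i]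
        C_eq[rule_format, OF x] p by simp
  next
    case False
    then have pos: "0 < x $ i" and le: "x $ i \<le> 1" for i
      using x by (auto simp: less_eq_vec_def less_le)
    define z where "z i = generator_inv \<Psi> (x $ i)" for i
    have z: "0 \<le> z i" "\<Psi> (z i) = x $ i" for i
      using generator_inv[OF \<Psi> pos le] by (auto simp: z_def)
    \<comment> \<open>\<open>y\<close> has the same arguments \<open>z i\<close> under
      \<open>\<psi>\<^sub>1\<close> as \<open>x\<close> has under \<open>\<Psi>\<close>. Passing
      from \<open>\<Psi>\<close> to \<open>\<psi>\<^sub>1\<close> at the common sum costs
      \<open>p\<close>, and moving from \<open>y\<close> to \<open>x\<close> costs \<open>p\<close>
      per coordinate.\<close>
    define y where "y = (\<chi> i. \<psi>\<^sub>1 (z i))"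
    have y: "y \<in> {0..1}"
      using generator_bounds[OF g(1) z(1)] by (auto simp: y_def less_eq_vec_def)
    have "x = (\<chi> i. \<Psi> (z i))" using z by (simp add: vec_eq_iff)
    then have "archimedean_function \<Psi> x = \<Psi> (\<Sum>i\<in>UNIV. z i)"
      using archimedean_function_generator[OF \<Psi> z(1)] by simp
    moreover have "C y = \<psi>\<^sub>1 (\<Sum>i\<in>UNIV. z i)"
      using C_eq y archimedean_function_generator[OF g(1) z(1)] by (simp add: y_def)
    ultimately have "\<bar>archimedean_function \<Psi> x - C y\<bar> \<le> p"
      using close[of "\<Sum>i\<in>UNIV. z i"] z(1) by (simp add: sum_nonneg)
    moreover have "\<bar>C y - C x\<bar> \<le> (\<Sum>i\<in>UNIV. \<bar>y $ i - x $ i\<bar>)"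
      by (rule archimedean_copula_lipschitz[OF C y x])
    moreover have "(\<Sum>i\<in>UNIV. \<bar>y $ i - x $ i\<bar>) \<le> (\<Sum>i\<in>(UNIV :: 'n set). p)"
      using close[OF z(1)] z(2) by (intro sum_mono) (simp add: y_def abs_minus_commute)
    ultimately show ?thesis by (simp add: algebra_simps)
  qed
qed

section \<open>Boxes\<close>

definition half_open_box :: "(real ^ 'n) \<Rightarrow> (real ^ 'n) \<Rightarrow> (real ^ 'n) set" where
  "half_open_box a b = {x. \<forall>i. a $ i < x $ i \<and> x $ i \<le> b $ i}"

lemma half_open_box_measurable [measurable]: "half_open_box a b \<in> sets borel"
  unfolding half_open_box_def by measurable

text \<open>Inclusion-exclusion, one lower bound at a time: each costs a factor 2.\<close>

lemma measure_half_open_box_close: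
  fixes a b :: "real ^ 'n"
  assumes M: "cube_measure_with_df C M" and M': "cube_measure_with_df C' M'"
    and close: "\<And>x. x \<in> {0..1} \<Longrightarrow> \<bar>C x - C' x\<bar> \<le> e"
    and ab: "a \<in> {0..1}" "b \<in> {0..1}"
  shows "\<bar>measure M (half_open_box a b) - measure M' (half_open_box a b)\<bar> \<le> 2 ^ CARD('n) * e"
proof -
  interpret M: prob_space M using M by (simp add: cube_measure_with_df_def)
  interpret M': prob_space M' using M' by (simp add: cube_measure_with_df_def)
  have [measurable_cong]: "sets M = sets borel" "sets M' = sets borel"
    using M M' by (simp_all add: cube_measure_with_df_def)
  define B where "B S b = {x. (\<forall>i\<in>S. a $ i < x $ i) \<and> (\<forall>i. x $ i \<le> b $ i)}" for S and b :: "real ^ 'n"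
  have [measurable]: "B S b \<in> sets borel" for S b
    unfolding B_def by measurable
  have "\<bar>measure M (B S b) - measure M' (B S b)\<bar> \<le> 2 ^ card S * e"
    if "finite S" "b \<in> {0..1}" for S b
    using that
  proof (induction S arbitrary: b rule: finite_induct)
    case empty
    have "B {} b = {..b}" by (auto simp: B_def less_eq_vec_def)
    then show ?case using close[OF empty] M M' empty by (simp add: cube_measure_with_df_def)
  next
    case (insert j S)
    \<comment> \<open>Lowering the \<open>j\<close>-th upper bound to \<open>a $ j\<close> singles
      out the points that violate the new lower bound. The minimum keeps the smaller set inside the
      larger one even when \<open>a $ j\<close> exceeds \<open>b $ j\<close>.\<close>
    define b' where "b' = (\<chi> i. if i = j then min (a $ i) (b $ i) else b $ i)"
    have b': "b' \<in> {0..1}"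
      using ab(1) insert.prems by (auto simp: b'_def less_eq_vec_def intro: min.coboundedI2)
    have "B (insert j S) b = B S b - B S b'"
      by (auto simp: B_def b'_def not_le split: if_splits)
    moreover have "B S b' \<subseteq> B S b"
      by (auto simp: B_def b'_def)
    ultimately have "measure M (B (insert j S) b) = measure M (B S b) - measure M (B S b')"
      "measure M' (B (insert j S) b) = measure M' (B S b) - measure M' (B S b')"
      by (simp_all add: M.finite_measure_Diff M'.finite_measure_Diff)
    then show ?case
      using insert.IH[OF insert.prems] insert.IH[OF b'] insert.hyps by simp
  qed
  from this[of UNIV b] show ?thesis using ab by (simp add: B_def half_open_box_def all_conj_distrib)
qed

text \<open>As \<open>x\<close> may lie on the boundary of the cube, it is first moved by a fraction
  \<open>t\<close> towards the centre of the cube; the box is placed around the new point.\<close>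

lemma open_contains_half_open_box:
  fixes U :: "(real ^ 'n) set"
  assumes U: "open U" and x: "x \<in> U" "x \<in> {0..1}"
  obtains a b where "half_open_box a b \<subseteq> U" "\<forall>i. 0 < a $ i \<and> a $ i < b $ i \<and> b $ i \<le> 1"
proof -
  obtain e where e: "0 < e" "ball x e \<subseteq> U" using U x(1) open_contains_ball by blast
  \<comment> \<open>Each coordinate of the box stays within \<open>t\<close> of \<open>x\<close>, so
    the distance is at most the dimension times \<open>t\<close>; the added 1 makes this strictly
    less than \<open>e\<close>.\<close>
  define t where "t = min 1 (e / (real CARD('n) + 1))"
  have t: "0 < t" "t \<le> 1" using e by (auto simp: t_def)
  have "t \<le> e / (real CARD('n) + 1)" by (simp add: t_def)
  then have "t * (real CARD('n) + 1) \<le> e"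
    by (simp only: pos_le_divide_eq[of "real CARD('n) + 1"] of_nat_0_less_iff add_nonneg_pos of_nat_0_le_iff zero_less_one)
  then have te: "real CARD('n) * t < e" using t by (simp add: algebra_simps)
  \<comment> \<open>The moved point is \<open>(1 - t) * x $ i + t / 2\<close>; offsets of
    \<open>t / 4\<close> to either side keep the corners strictly between 0 and 1.\<close>
  define a where "a = (\<chi> i. (1 - t) * x $ i + t / 4)"
  define b where "b = (\<chi> i. (1 - t) * x $ i + 3 * t / 4)"
  have xi: "0 \<le> x $ i" "x $ i \<le> 1" for i using x(2) by (auto simp: less_eq_vec_def)
  have lo: "0 \<le> (1 - t) * x $ i" "(1 - t) * x $ i \<le> 1 - t" "x $ i - t \<le> (1 - t) * x $ i"
    "(1 - t) * x $ i \<le> x $ i" for i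
  proof -
    show "0 \<le> (1 - t) * x $ i" using xi[of i] t by simp
    show "(1 - t) * x $ i \<le> 1 - t" using xi[of i] t by (simp add: mult_left_le)
    have "0 \<le> t * x $ i" "t * x $ i \<le> t" using xi[of i] t by (simp_all add: mult_left_le)
    then show "x $ i - t \<le> (1 - t) * x $ i" "(1 - t) * x $ i \<le> x $ i"
      by (simp_all add: left_diff_distrib)
  qed
  show thesis
  proof
    show "half_open_box a b \<subseteq> U"
    proof
      fix u assume u: "u \<in> half_open_box a b"
      have "\<bar>(u - x) $ i\<bar> \<le> t" for i
      proof -
        have "a $ i < u $ i" "u $ i \<le> b $ i" using u by (auto simp: half_open_box_def)
        then have "(1 - t) * x $ i + t / 4 < u $ i" "u $ i \<le> (1 - t) * x $ i + 3 * t / 4"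
          by (simp_all add: a_def b_def)
        then have "\<bar>u $ i - x $ i\<bar> \<le> t" using lo[of i] t by linarith
        then show ?thesis by simp
      qed
      then have "(\<Sum>i\<in>UNIV. \<bar>(u - x) $ i\<bar>) \<le> (\<Sum>i\<in>(UNIV :: 'n set). t)" by (intro sum_mono)
      then have "norm (u - x) < e"
        using norm_le_l1_cart[of "u - x"] te by simp
      then have "u \<in> ball x e" by (simp add: dist_norm norm_minus_commute)
      then show "u \<in> U" using e by blast
    qed
    show "\<forall>i. 0 < a $ i \<and> a $ i < b $ i \<and> b $ i \<le> 1"
    proof
      fix i
      show "0 < a $ i \<and> a $ i < b $ i \<and> b $ i \<le> 1"
        using lo(1,2)[of i] t by (simp add: a_def b_def)
    qed
  qed
qed

section \<open>Density and category\<close>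

text \<open>The independence part of the mixture contributes \<open>p\<close> times the uniform mass
  of the preimage of the box, and this preimage contains a nondegenerate closed box.\<close>

lemma archimedean_copula_charging_box_dense:
  fixes C :: "(real ^ 'n) \<Rightarrow> real"
  assumes C: "C \<in> archimedean_copulas" and e: "0 < e"
    and ab: "\<And>i. 0 < a $ i" "\<And>i. a $ i < b $ i" "\<And>i. b $ i \<le> 1"
  obtains C' where "C' \<in> archimedean_copulas" "\<And>x. x \<in> {0..1} \<Longrightarrow> \<bar>C' x - C x\<bar> \<le> e"
    "0 < measure (copula_measure C') (half_open_box a b)"
proof -
  obtain \<psi> where g: "archimedean_generator \<psi>" and C_eq: "\<forall>x\<in>{0..1}. C x = archimedean_function \<psi> x"
    and M: "cube_measure_with_df C (copula_measure C)" using archimedean_copulaE[OF C] .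
  define M where "M = copula_measure C"
  \<comment> \<open>The second bound cancels the factor in
    \<open>archimedean_convex_comb_close\<close>; the first keeps \<open>p\<close> below 1.\<close>
  define p where "p = min (1 / 2) (e / (real CARD('n) + 1))"
  have p: "0 < p" "p < 1" using e by (auto simp: p_def min_def add_pos_nonneg)
  have "p \<le> e / (real CARD('n) + 1)" by (simp add: p_def)
  then have pe: "(real CARD('n) + 1) * p \<le> e"
    by (simp only: pos_le_divide_eq[of "real CARD('n) + 1"] add_nonneg_pos of_nat_0_le_iff zero_less_one mult.commute)
  define L where "L = uniform_measure lborel {0..1 :: real ^ 'n}"
  have L: "cube_measure_with_df (\<lambda>x. \<Prod>i\<in>UNIV. x $ i) L"
    unfolding L_def by (rule cube_measure_independence)
  have L_eq: "\<forall>x::real ^ 'n\<in>{0..1}. (\<Prod>i\<in>UNIV. x $ i) = archimedean_function (\<lambda>z. exp (- z)) x"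
    by (simp add: archimedean_function_exp del: atLeastAtMost_iff)
  define \<Psi> where "\<Psi> = (\<lambda>z. (1 - p) * \<psi> z + p * exp (- z))"
  have \<Psi>: "archimedean_generator \<Psi>"
    unfolding \<Psi>_def by (rule generator_convex_comb[OF g generator_exp p])
  let ?T = "generator_change_vec (\<lambda>z. exp (- z)) \<Psi> :: real ^ 'n \<Rightarrow> real ^ 'n"
  obtain N where N: "cube_measure_with_df (archimedean_function \<Psi>) N"
    and meas: "\<forall>A\<in>sets borel. measure N A =
      (1 - p) * measure M (generator_change_vec \<psi> \<Psi> -` A) + p * measure L (?T -` A)"
    unfolding \<Psi>_def M_def by (rule cube_measure_convex_comb[OF g generator_exp M C_eq L L_eq p])
  interpret L: prob_space L using L by (simp add: cube_measure_with_df_def)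
  have sets_L: "sets L = sets borel" using L by (simp add: cube_measure_with_df_def)
  define s t where "s i = generator_inv \<Psi> (a $ i)" and "t i = generator_inv \<Psi> (b $ i)" for i
  have st0: "0 \<le> s i" "0 \<le> t i" for i by (simp_all add: s_def t_def)
  have st: "\<Psi> (s i) = a $ i" "\<Psi> (t i) = b $ i" for i
    using ab(1,2,3)[of i] by (auto simp: s_def t_def intro!: generator_inv[OF \<Psi>])
  have ts: "t i < s i" for i
  proof (rule ccontr)
    assume "\<not> t i < s i"
    then have "\<Psi> (t i) \<le> \<Psi> (s i)" using st0 by (intro generator_antimono[OF \<Psi>]) auto
    then show False using ab(2)[of i] st by simp
  qed
  \<comment> \<open>In the coordinates of the independence copula the box has corners
    \<open>exp (- s i)\<close> and \<open>exp (- t i)\<close>. Taking the midpoint as lower corner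
    fits a closed box into the half-open one.\<close>
  define u v where "u = (\<chi> i. (exp (- s i) + exp (- t i)) / 2)" and "v = (\<chi> i. exp (- t i))"
  have uv: "exp (- s i) < u $ i" "u $ i < v $ i" "v $ i \<le> 1" "v $ i = exp (- t i)" for i
    using ts[of i] st0(2)[of i] by (simp_all add: u_def v_def)
  have u0: "0 < u $ i" for i using uv(1)[of i] exp_gt_zero[of "- s i"] by linarith
  have box: "cbox u v \<subseteq> ?T -` half_open_box a b"
  proof
    fix x assume "x \<in> cbox u v"
    then have x: "u $ i \<le> x $ i" "x $ i \<le> v $ i" for i
      by (simp_all add: mem_box_cart)
    have "a $ i < ?T x $ i \<and> ?T x $ i \<le> b $ i" for i
    proof -
      have x01: "0 < x $ i" "x $ i \<le> 1" using x[of i] u0[of i] uv(3)[of i] by linarith+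
      have "0 < \<Psi> (s i)" "0 < \<Psi> (t i)" using st[of i] ab(1,2)[of i] by auto
      then have "generator_change (\<lambda>z. exp (- z)) \<Psi> (x $ i) \<le> \<Psi> (t i) \<longleftrightarrow> x $ i \<le> exp (- t i)"
        "generator_change (\<lambda>z. exp (- z)) \<Psi> (x $ i) \<le> \<Psi> (s i) \<longleftrightarrow> x $ i \<le> exp (- s i)"
        using generator_change_le_iff[OF generator_exp \<Psi> x01] st0 by blast+
      then show ?thesis
        using x[of i] uv[of i] st[of i] by (auto simp: generator_change_vec_def not_le[symmetric])
    qed
    then show "x \<in> ?T -` half_open_box a b" by (simp add: half_open_box_def)
  qed
  have "0 < (\<Prod>i\<in>UNIV. v $ i - u $ i)"
    using uv(2) by (intro prod_pos) simp
  also have "\<dots> = measure lborel (cbox u v)"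
    using uv(2) by (intro measure_lborel_cube[symmetric] less_imp_le)
  also have "cbox u v = {0..1} \<inter> cbox u v"
  proof -
    have "0 \<le> u" "v \<le> 1" using u0 uv(3) by (auto simp: less_eq_vec_def less_imp_le)
    then show ?thesis by (auto simp: interval_cbox_cart[symmetric] intro: order_trans)
  qed
  also have "measure lborel \<dots> = measure L (cbox u v)"
    unfolding L_def by (rule measure_uniform_unit_cube[symmetric]) simp
  also have "\<dots> \<le> measure L (?T -` half_open_box a b)"
    using measurable_sets[OF generator_change_vec_measurable[OF generator_exp \<Psi>] half_open_box_measurable]
    by (intro L.finite_measure_mono[OF box]) (simp add: sets_L)
  finally have "0 < measure N (half_open_box a b)"
    unfolding meas[rule_format, OF half_open_box_measurable] using p by (intro add_nonneg_pos mult_pos_pos) auto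
  moreover define C' where "C' = restrict (archimedean_function \<Psi>) {0..1 :: real ^ 'n}"
  ultimately have "0 < measure (copula_measure C') (half_open_box a b)"
    using archimedean_copulaI(2)[OF N \<Psi>] by simp
  moreover have "C' \<in> archimedean_copulas"
    unfolding C'_def by (rule archimedean_copulaI(1)[OF N \<Psi>])
  moreover have "\<bar>C' x - C x\<bar> \<le> e" if "x \<in> {0..1}" for x
    using archimedean_convex_comb_close[OF C C_eq g generator_exp p that] pe that
    by (simp add: C'_def \<Psi>_def)
  ultimately show thesis using that by blast
qed

section \<open>The uniform metric and nowhere dense sets\<close>

lemma mdist_archimedean_metric_le:
  assumes "A \<in> archimedean_copulas" "B \<in> archimedean_copulas"
    and "\<And>x. x \<in> {0..1} \<Longrightarrow> \<bar>A x - B x\<bar> \<le> e"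
  shows "mdist archimedean_metric A B \<le> e"
  unfolding mdist_archimedean_metric[OF assms(1,2)]
  by (rule cSUP_least) (use assms(3) in \<open>auto simp: less_eq_vec_def\<close>)

lemma abs_le_mdist_archimedean_metric:
  assumes AB: "A \<in> archimedean_copulas" "B \<in> archimedean_copulas" and x: "x \<in> {0..1}"
  shows "\<bar>A x - B x\<bar> \<le> mdist archimedean_metric A B"
proof -
  have bounds: "0 \<le> C x \<and> C x \<le> 1" if "C \<in> archimedean_copulas" "x \<in> {0..1}" for C :: "real ^ 'a \<Rightarrow> real" and x
  proof -
    have M: "cube_measure_with_df C (copula_measure C)" by (rule archimedean_copulaE[OF that(1)])
    then have "C x = measure (copula_measure C) {..x}" "prob_space (copula_measure C)"
      using that(2) by (simp_all add: cube_measure_with_df_def)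
    then show ?thesis by (simp add: prob_space.prob_le_1)
  qed
  have "bdd_above ((\<lambda>x. \<bar>A x - B x\<bar>) ` {0..1})"
  proof (rule bdd_aboveI2)
    fix y :: "real ^ 'a" assume "y \<in> {0..1}"
    then show "\<bar>A y - B y\<bar> \<le> 1" using bounds[OF AB(1)] bounds[OF AB(2)] by (smt (verit))
  qed
  then show ?thesis
    unfolding mdist_archimedean_metric[OF AB] using x by (intro cSUP_upper)
qed

text \<open>Otherwise some ball would lie in the closure of \<open>S\<close>; it contains a point
  \<open>y\<close> with a neighbourhood missing \<open>S\<close>, so \<open>y\<close> cannot be in
  that closure.\<close>

lemma (in Metric_space) nowhere_dense_inI:
  assumes "S \<subseteq> M"
    and "\<And>x r. x \<in> M \<Longrightarrow> 0 < r \<Longrightarrow> \<exists>y\<in>mball x r. \<exists>r'>0. mball y r' \<inter> S = {}"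
  shows "nowhere_dense_in mtopology S"
  unfolding nowhere_dense_in_def
proof (intro conjI equals0I)
  show "S \<subseteq> topspace mtopology" using assms(1) by simp
  fix x assume "x \<in> mtopology interior_of (mtopology closure_of S)"
  then obtain W where W: "openin mtopology W" "x \<in> W" "W \<subseteq> mtopology closure_of S"
    by (auto simp: interior_of_def)
  then obtain r where r: "0 < r" "mball x r \<subseteq> W" "x \<in> M"
    by (meson openin_mtopology subset_iff)
  then obtain y r' where y: "y \<in> mball x r" "0 < r'" "mball y r' \<inter> S = {}"
    using assms(2) by blast
  then have "y \<in> mtopology closure_of S" using r W by blast
  then obtain z where "z \<in> S" "z \<in> mball y r'" using y(2) by (auto simp only: metric_closure_of)
  then show False using y(3) by blast
qed

text \<open>Every ball contains a copula \<open>C'\<close> giving positive mass \<open>m\<close> to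
  a box inside \<open>U\<close>. Box masses vary by at most \<open>2 ^ CARD('n)\<close> times the
  distance, so copulas closer to \<open>C'\<close> than \<open>m / 2 ^ CARD('n)\<close> still charge
  \<open>U\<close>.\<close>

lemma nowhere_dense_null_open:
  fixes U :: "(real ^ 'n) set"
  assumes U: "open U" "x \<in> U" "x \<in> {0..1}"
  shows "nowhere_dense_in (mtopology_of archimedean_metric)
    {C \<in> archimedean_copulas. emeasure (copula_measure C) U = 0}"
proof -
  interpret ar: Metric_space "archimedean_copulas :: (real ^ 'n \<Rightarrow> real) set" "mdist archimedean_metric"
    using Metric_space_mspace_mdist[of archimedean_metric] by simp
  obtain a b where box: "half_open_box a b \<subseteq> U"
    and "\<forall>i. 0 < a $ i \<and> a $ i < b $ i \<and> b $ i \<le> 1"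
    using open_contains_half_open_box[OF U] .
  then have ab: "0 < a $ i" "a $ i < b $ i" "b $ i \<le> 1" for i by simp_all
  have cube: "a \<in> {0..1}" "b \<in> {0..1}"
    using ab by (auto simp: less_eq_vec_def intro: less_imp_le order_trans)
      (meson less_imp_le order_trans)+
  let ?S = "{C \<in> archimedean_copulas. emeasure (copula_measure C) U = 0}"
  have null: "measure (copula_measure C) (half_open_box a b) = 0" if "C \<in> ?S" for C
  proof -
    have "cube_measure_with_df C (copula_measure C)" 
      using that by (auto elim: archimedean_copulaE)
    then have "U \<in> sets (copula_measure C)" using U(1) by (simp add: cube_measure_with_df_def)
    then have "emeasure (copula_measure C) (half_open_box a b) \<le> emeasure (copula_measure C) U"
      by (rule emeasure_mono[OF box])
    then show ?thesis using that by (simp add: measure_def)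
  qed
  have "nowhere_dense_in ar.mtopology ?S"
  proof (rule ar.nowhere_dense_inI)
    fix C :: "real ^ 'n \<Rightarrow> real" and r :: real
    assume C: "C \<in> archimedean_copulas" and r: "0 < r"
    then obtain C' where C': "C' \<in> archimedean_copulas"
      and close: "\<And>x. x \<in> {0..1} \<Longrightarrow> \<bar>C' x - C x\<bar> \<le> r / 2"
      and pos: "0 < measure (copula_measure C') (half_open_box a b)"
      using archimedean_copula_charging_box_dense[OF C _ ab, of "r / 2"] by auto
    define m where "m = measure (copula_measure C') (half_open_box a b)"
    have "mdist archimedean_metric C' C \<le> r / 2"
      by (rule mdist_archimedean_metric_le[OF C' C close])
    then have "C' \<in> ar.mball C r" using C C' r by (simp add: ar.commute)
    moreover have "D \<notin> ?S" if D: "D \<in> ar.mball C' (m / 2 ^ CARD('n))" for D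
    proof
      assume "D \<in> ?S"
      then have D_ar: "D \<in> archimedean_copulas" by simp
      let ?d = "mdist archimedean_metric C' D"
      have "\<bar>C' x - D x\<bar> \<le> ?d" if "x \<in> {0..1}" for x
        by (rule abs_le_mdist_archimedean_metric[OF C' D_ar that])
      moreover have "cube_measure_with_df C' (copula_measure C')" "cube_measure_with_df D (copula_measure D)"
        using C' D_ar by (auto elim: archimedean_copulaE)
      ultimately have "\<bar>m - measure (copula_measure D) (half_open_box a b)\<bar> \<le> 2 ^ CARD('n) * ?d"
        unfolding m_def using cube by (intro measure_half_open_box_close)
      then have "m \<le> 2 ^ CARD('n) * ?d" using null[OF \<open>D \<in> ?S\<close>] by simp
      moreover have "?d < m / 2 ^ CARD('n)" using D by simp
      ultimately show False by (simp add: field_simps)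
    qed
    moreover have "0 < m / 2 ^ CARD('n)" using pos by (simp add: m_def)
    ultimately show "\<exists>y\<in>ar.mball C r. \<exists>r'>0. ar.mball y r' \<inter> ?S = {}" by blast
  qed auto
  then show ?thesis by (simp add: mtopology_of_def)
qed

theorem theorem6p4:
  assumes "CARD('n::finite) \<ge> 2"
  shows "comeager_in (mtopology_of archimedean_metric)
           {C \<in> (archimedean_copulas :: ((real ^ 'n) \<Rightarrow> real) set).
              measure_support (copula_measure C) = {0..1}}"
proof -
  obtain B :: "(real ^ 'n) set set" where B: "countable B" "topological_basis B"
    using ex_countable_basis by blast
  let ?N = "\<lambda>U. {C \<in> archimedean_copulas. emeasure (copula_measure C) U = 0} :: (real ^ 'n \<Rightarrow> real) set"
  \<comment> \<open>Basic sets that miss the cube are null for every copula, so they must be left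
    out.\<close>
  let ?F = "?N ` {U \<in> B. U \<inter> {0..1} \<noteq> {}}"
  have F: "countable ?F" using B(1) by simp
  have nd: "nowhere_dense_in (mtopology_of archimedean_metric) N" if "N \<in> ?F" for N
    using that topological_basis_open[OF B(2)] nowhere_dense_null_open by blast
  have cover: "C \<in> \<Union>?F"
    if C: "C \<in> archimedean_copulas" and supp: "measure_support (copula_measure C) \<noteq> {0..1}"
    for C :: "real ^ 'n \<Rightarrow> real"
  proof -
    have M: "cube_measure_with_df C (copula_measure C)" by (rule archimedean_copulaE[OF C])
    then have sets: "sets (copula_measure C) = sets borel" by (simp add: cube_measure_with_df_def)
    \<comment> \<open>The complement of the cube is open and null, so the support lies in the cube,
      and a support other than the cube must miss one of its points.\<close>
    have "AE x in copula_measure C. x \<notin> - {0..1}"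
      using AE_cube_measure[OF M] by eventually_elim (simp add: less_eq_vec_def)
    then have "- {0..1} \<in> null_sets (copula_measure C)"
      by (subst AE_iff_null_sets) (simp_all add: sets)
    moreover have "open (- {0..1 :: real ^ 'n})"
      by (simp add: interval_cbox_cart open_Compl closed_cbox)
    ultimately have "measure_support (copula_measure C) \<subseteq> {0..1}"
      unfolding measure_support_def null_sets_def by blast
    with supp obtain x where x: "x \<in> {0..1}" "x \<notin> measure_support (copula_measure C)" by blast
    then obtain V where V: "open V" "x \<in> V" "emeasure (copula_measure C) V = 0"
      by (auto simp: measure_support_def)
    then obtain U where U: "U \<in> B" "x \<in> U" "U \<subseteq> V"
      using topological_basisE[OF B(2)] by metis
    have "emeasure (copula_measure C) U \<le> emeasure (copula_measure C) V"
      using U(3) V(1) by (intro emeasure_mono) (simp_all add: sets)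
    then have "emeasure (copula_measure C) U = 0" using V(3) by simp
    then show ?thesis using U x C by blast
  qed
  have sub: "archimedean_copulas - {C \<in> archimedean_copulas. measure_support (copula_measure C) = {0..1}} \<subseteq> \<Union>?F"
    using cover by blast
  show ?thesis
    unfolding comeager_in_def meager_in_def topspace_mtopology_of mspace_archimedean_metric
    using F nd sub by (intro conjI exI[of _ ?F] ballI Diff_subset Collect_restrict)
qed

end
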